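(* Let $G$ be a connected bipartite simple graph on $n>2$ vertices with vertex set $V(G)=\{1,\dots,n\}$. For $k\ge 0$ define $$\gamma^{(k)}=\sqrt{\frac{\sum_{i\in V(G)} d_{k+1}^2(i)}{\sum_{i\in V(G)} d_k^2(i)}}.$$ Then for every $k\ge 0$, $$EE(G)\ge 2\cosh\left(\gamma^{(k)}\right)+n-2,$$ and equality holds if and only if $G$ is isomorphic to a complete bipartite graph $K_{p,q}$ (with $p+q=n$).
   Context: For a vertex $i$, $d_k(i)$ denotes the number of walks of length $k$ in $G$ starting at $i$; thus $d_0(i)=1$, $d_1(i)$ is the degree of $i$, and $d_{k+1}(i)=\sum_{j\text{ adjacent to } i} d_k(j)$. The Estrada index of $G$ is $EE(G)=\sum_{i=1}^n e^{\lambda_i}$, where $\lambda_1\ge\dots\ge\lambda_n$ are the eigenvalues of the adjacency matrix of $G$. *)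

theory Defs
  imports
    Complex_Main
    "HOL-Computational_Algebra.Polynomial"
    "Graph_Theory.Arc_Walk"
    "Graph_Theory.Digraph_Component"
    "Graph_Theory.Pair_Digraph"
    "Graph_Theory.Kuratowski"
    "Jordan_Normal_Form.Char_Poly"
begin

text \<open>A simple graph is a finite set of vertices with a symmetric irreflexive adjacency
  relation, i.e. an element of the locale \<^locale>\<open>pair_graph\<close>; an edge contributes
  both of its orientations to \<^const>\<open>parcs\<close>.\<close>

definition bipartite :: "'a pair_pre_digraph \<Rightarrow> bool" where
  "bipartite G \<longleftrightarrow>
     (\<exists>U V. pverts G = U \<union> V \<and> U \<inter> V = {} \<and> parcs G \<subseteq> U \<times> V \<union> V \<times> U)"

definition num_walks :: "'a pair_pre_digraph \<Rightarrow> nat \<Rightarrow> 'a \<Rightarrow> nat" where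
  "num_walks G k i = card {p. length p = k \<and> (\<exists>j. pre_digraph.awalk (with_proj G) i p j)}"

definition walk_gamma :: "'a pair_pre_digraph \<Rightarrow> nat \<Rightarrow> real" where
  "walk_gamma G k =
     sqrt ((\<Sum>i\<in>pverts G. (real (num_walks G (k + 1) i))\<^sup>2) /
           (\<Sum>i\<in>pverts G. (real (num_walks G k i))\<^sup>2))"

text \<open>The vertices are \<open>1, \<dots>, n\<close> whereas matrix indices start at \<open>0\<close>, hence the shift.\<close>

definition adj_matrix :: "nat pair_pre_digraph \<Rightarrow> real mat" where
  "adj_matrix G = mat (card (pverts G)) (card (pverts G))
     (\<lambda>(i, j). if (i + 1, j + 1) \<in> parcs G then 1 else 0)"

text \<open>The eigenvalues are counted with multiplicity, as the roots of the characteristic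
  polynomial. No eigenvalue is lost by working over the reals, since the matrix is symmetric.\<close>

definition estrada_index :: "nat pair_pre_digraph \<Rightarrow> real" where
  "estrada_index G = (\<Sum>x\<in>#proots (char_poly (adj_matrix G)). exp x)"

lemma set_proots_adj_matrix:
  "set_mset (proots (char_poly (adj_matrix G))) = Collect (eigenvalue (adj_matrix G))"
proof -
  have A: "adj_matrix G \<in> carrier_mat (card (pverts G)) (card (pverts G))"
    by (simp add: adj_matrix_def)
  have "char_poly (adj_matrix G) \<noteq> 0"
    using degree_monic_char_poly[OF A] by auto
  then show ?thesis by (auto simp: eigenvalue_root_char_poly[OF A])
qed

lemma estrada_index_eq_sum_list:
  assumes "char_poly (adj_matrix G) = (\<Prod>x\<leftarrow>ls. [:- x, 1:])"
  shows "estrada_index G = (\<Sum>x\<leftarrow>ls. exp x)"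
proof -
  have "proots (\<Prod>x\<leftarrow>ls. [:- x, 1:]) = mset ls" for ls :: "real list"
  proof (induction ls)
    case (Cons a ls)
    have "(\<Prod>x\<leftarrow>ls. [:- x, 1:]) \<noteq> 0" by (auto simp: prod_list_zero_iff)
    then have "proots (\<Prod>x\<leftarrow>a # ls. [:- x, 1:]) = proots [:- a, 1:] + mset ls"
      using Cons by (simp add: proots_mult del: mult_pCons_left)
    then show ?case by simp
  qed simp
  then show ?thesis
    by (simp add: estrada_index_def assms flip: sum_mset_sum_list)
qed

lemma num_walks_0:
  assumes "i \<in> pverts G"
  shows "num_walks G 0 i = 1"
proof -
  have "{p. length p = 0 \<and> (\<exists>j. pre_digraph.awalk (with_proj G) i p j)} = {[]}"
    using assms by (auto simp: pre_digraph.awalk_def pre_digraph.cas.simps)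
  then show ?thesis by (simp add: num_walks_def)
qed

lemma num_walks_Suc:
  assumes "pair_graph G" "i \<in> pverts G"
  shows "num_walks G (Suc k) i = (\<Sum>j | (i, j) \<in> parcs G. num_walks G k j)"
proof -
  interpret pair_graph G by fact
  let ?W = "\<lambda>k i. {p. length p = k \<and> (\<exists>j. awalk i p j)}"
  have eq: "?W (Suc k) i = (\<Union>j\<in>{j. (i, j) \<in> parcs G}. (#) (i, j) ` ?W k j)"
  proof (intro Set.set_eqI iffI)
    fix p assume "p \<in> ?W (Suc k) i"
    then obtain e q l where "p = e # q" "length q = k" "awalk i (e # q) l"
      by (auto simp: length_Suc_conv)
    then show "p \<in> (\<Union>j\<in>{j. (i, j) \<in> parcs G}. (#) (i, j) ` ?W k j)"
      by (cases e) (auto simp: awalk_Cons_iff)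
  qed (use assms(2) in \<open>auto simp: awalk_Cons_iff\<close>)
  have fin: "finite (?W k j)" for k j
    by (rule finite_subset[OF _ finite_lists_length_eq[OF pair_finite_arcs, of k]])
       (auto simp: awalk_def)
  have "{j. (i, j) \<in> parcs G} \<subseteq> pverts G" by (auto dest: in_arcsD2)
  then have finN: "finite {j. (i, j) \<in> parcs G}"
    using pair_finite_verts finite_subset by blast
  show ?thesis
    unfolding num_walks_def eq
    by (subst card_UN_disjoint) (use fin finN in \<open>auto simp: card_image\<close>)
qed

end

theory Submission
  imports Defs "Jordan_Normal_Form.Schur_Decomposition"
begin

text \<open>The adjacency matrix \<open>A\<close> is orthogonally diagonalisable, and changing the sign of the
  coordinates in one part of the bipartition turns \<open>A\<close> into \<open>- A\<close>. So the spectrum is symmetric and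
  the Estrada index is the sum of \<open>cosh \<lambda>\<close> over the eigenvalues. Since the walk counts satisfy
  \<open>d\<^bsub>k+1\<^esub> = A d\<^bsub>k\<^esub>\<close>, the eigenvalue \<open>\<mu>\<close> of largest modulus satisfies \<open>\<bar>\<mu>\<bar> \<ge> \<gamma>\<^bsup>(k)\<^esup>\<close>. Both \<open>\<mu>\<close> and
  \<open>- \<mu>\<close> occur, and each of the other \<open>n - 2\<close> eigenvalues contributes at least \<open>1\<close>.

  Equality means that \<open>\<bar>\<mu>\<bar> = \<gamma>\<^bsup>(k)\<^esup>\<close> and all other eigenvalues vanish. Then \<open>A\<^sup>3 = \<mu>\<^sup>2 A\<close>, so the ends
  of a walk of length \<open>3\<close> are adjacent, and by connectedness so are any two vertices in different
  parts. Conversely, in \<open>K\<^bsub>p,q\<^esub>\<close> the squares of the eigenvalues sum to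
  the number \<open>2 p q\<close> of arcs, while \<open>\<gamma>\<^bsup>(k)\<^esup> = sqrt (p q)\<close>, which leaves nothing for the eigenvalues
  other than \<open>\<mu>\<close> and \<open>- \<mu>\<close>.\<close>

section \<open>Orthogonal diagonalisation of symmetric real matrices\<close>

text \<open>Over the complex numbers the characteristic polynomial splits, so some complex
  eigenvalue \<open>a\<close> with eigenvector \<open>v\<close> exists. The form \<open>q\<close>,
  which is v* A v, equals \<open>a\<close> times the squared norm \<open>s\<close> of
  \<open>v\<close>, and it is its own conjugate because A is real and symmetric. Since
  \<open>s\<close> is nonzero, \<open>a\<close> is real and is a root of the real
  polynomial.\<close>

lemma symmetric_real_mat_eigenvalue:
  fixes A :: "real mat"
  assumes A: "A \<in> carrier_mat n n" and sym: "transpose_mat A = A" and n: "n \<noteq> 0"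
  shows "\<exists>e. eigenvalue A e"
proof -
  let ?C = "map_mat complex_of_real A"
  have C: "?C \<in> carrier_mat n n" using A by simp
  obtain as where as: "char_poly ?C = (\<Prod>a\<leftarrow>as. [:- a, 1:])" "length as = n"
    using char_poly_factorized[OF C] by blast
  then obtain a where "a \<in> set as" using n by (cases as) auto
  then have root: "poly (char_poly ?C) a = 0"
    unfolding as by (auto simp: poly_prod_list prod_list_zero_iff)
  then have "eigenvalue ?C a" by (simp add: eigenvalue_root_char_poly[OF C])
  then obtain v where v: "v \<in> carrier_vec n" "v \<noteq> 0\<^sub>v n" "?C *\<^sub>v v = a \<cdot>\<^sub>v v"
    unfolding eigenvalue_def eigenvector_def using A by auto
  have Cv: "(\<Sum>j<n. of_real (A $$ (i,j)) * v $ j) = a * v $ i" if "i < n" for i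
    using arg_cong[OF v(3), of "\<lambda>w. w $ i"] that A v(1)
    by (simp add: scalar_prod_def lessThan_atLeast0)
  have symA: "A $$ (i,j) = A $$ (j,i)" if "i < n" "j < n" for i j
    using arg_cong[OF sym, of "\<lambda>M. M $$ (i,j)"] that A by simp
  define q where "q = (\<Sum>i<n. \<Sum>j<n. cnj (v $ i) * of_real (A $$ (i,j)) * v $ j)"
  define s where "s = (\<Sum>i<n. (cmod (v $ i))\<^sup>2)"
  have "q = (\<Sum>i<n. cnj (v $ i) * (a * v $ i))"
    unfolding q_def by (intro sum.cong refl) (simp add: Cv[symmetric] sum_distrib_left mult.assoc)
  also have "\<dots> = a * of_real s"
    unfolding s_def by (simp add: sum_distrib_left complex_norm_square mult_ac del: of_real_power)
  finally have q: "q = a * of_real s" .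
  have "cnj q = (\<Sum>i<n. \<Sum>j<n. cnj (v $ j) * of_real (A $$ (j,i)) * v $ i)"
    unfolding q_def by (auto intro!: sum.cong simp: symA mult_ac)
  also have "\<dots> = q" unfolding q_def by (rule sum.swap)
  finally have "cnj q = q" .
  moreover have "s \<noteq> 0"
  proof
    assume "s = 0"
    then have "\<forall>i<n. v $ i = 0"
      unfolding s_def by (subst (asm) sum_nonneg_eq_0_iff) auto
    with v(1,2) show False by auto
  qed
  ultimately have "cnj a = a" by (simp add: q)
  then have "a = of_real (Re a)" by (metis Reals_cnj_iff of_real_Re)
  moreover have "char_poly ?C = map_poly of_real (char_poly A)"
    by (rule of_real_hom.char_poly_hom[OF A])
  ultimately have "complex_of_real (poly (char_poly A) (Re a)) = 0"
    using root by (metis of_real_hom.poly_map_poly)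
  then show ?thesis by (auto simp: eigenvalue_root_char_poly[OF A])
qed

text \<open>\<open>corthogonal_inv\<close> divides each conjugated column by its squared norm; real
  unit vectors are left unchanged.\<close>

lemma corthogonal_inv_orthonormal:
  fixes ws :: "real vec list"
  assumes ws: "set ws \<subseteq> carrier_vec n" "length ws = n" and norm: "\<And>w. w \<in> set ws \<Longrightarrow> w \<bullet> w = 1"
  shows "corthogonal_inv (mat_of_cols n ws) = transpose_mat (mat_of_cols n ws)"
proof -
  have "map vec_inv ws = ws"
    by (rule map_idI) (simp add: vec_inv_def norm conjugate_vec_def)
  then show ?thesis
    using ws by (simp add: corthogonal_inv_def transpose_mat_of_cols)
qed

text \<open>Complete \<open>v\<close> to a basis, apply Gram-Schmidt, which keeps the first vector,
  and normalise. This supplies the orthogonal change of basis for splitting off an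
  eigenvector.\<close>

lemma orthonormal_list_with_hd_parallel:
  fixes v :: "real vec"
  assumes v: "v \<in> carrier_vec n" "v \<noteq> 0\<^sub>v n"
  obtains c ws where "hd ws = c \<cdot>\<^sub>v v" "c \<noteq> 0" "set ws \<subseteq> carrier_vec n" "corthogonal ws"
    "length ws = n" "\<And>w. w \<in> set ws \<Longrightarrow> w \<bullet> w = 1"
proof -
  interpret cof_vec_space n "TYPE(real)" .
  define b where "b = basis_completion v"
  note b = basis_completion[OF v, folded b_def]
  have n: "n \<noteq> 0" using v by auto
  then obtain vs where bv: "b = v # vs" using b(6,7) by (cases b) auto
  define us where "us = gram_schmidt n b"
  have us: "set us \<subseteq> carrier_vec n" "corthogonal us" "length us = n"
    using gram_schmidt_result[OF b(2,4,5) us_def] b(6) by auto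
  have hd: "hd us = v" unfolding us_def bv by (rule gram_schmidt_hd[OF v(1)])
  have pos: "u \<bullet> u > 0" if u: "u \<in> set us" for u
  proof -
    obtain i where "i < length us" "u = us ! i" using u by (auto simp: set_conv_nth)
    then have "u \<bullet>c u \<noteq> 0" using corthogonalD[OF us(2)] by blast
    moreover have "u \<bullet> u \<ge> 0" by (simp add: scalar_prod_def sum_nonneg)
    ultimately show ?thesis by (simp add: conjugate_vec_def)
  qed
  define f where "f = (\<lambda>u::real vec. (1 / sqrt (u \<bullet> u)) \<cdot>\<^sub>v u)"
  show thesis
  proof (rule that[of "map f us" "1 / sqrt (v \<bullet> v)"])
    show "hd (map f us) = (1 / sqrt (v \<bullet> v)) \<cdot>\<^sub>v v" using hd us(3) n by (cases us) (auto simp: f_def)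
    have "v \<in> set us" using hd us(3) n by (cases us) auto
    then show "1 / sqrt (v \<bullet> v) \<noteq> 0" using pos by force
    show "set (map f us) \<subseteq> carrier_vec n" using us(1) by (auto simp: f_def)
    show "length (map f us) = n" using us by simp
    show "w \<bullet> w = 1" if "w \<in> set (map f us)" for w
    proof -
      obtain u where u: "u \<in> set us" "w = f u" using \<open>w \<in> set (map f us)\<close> by auto
      have "u \<in> carrier_vec n" using u us by auto
      then show ?thesis using pos[OF u(1)] u(2) by (simp add: f_def field_simps)
    qed
    show "corthogonal (map f us)"
    proof (rule corthogonalI)
      fix i j assume ij: "i < length (map f us)" "j < length (map f us)"
      then have c: "us ! i \<in> carrier_vec n" "us ! j \<in> carrier_vec n" using us(1) by auto
      have "map f us ! i \<bullet>c map f us ! j =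
        (1 / sqrt (us ! i \<bullet> us ! i)) * ((1 / sqrt (us ! j \<bullet> us ! j)) * (us ! i \<bullet>c us ! j))"
        using ij c by (simp add: f_def conjugate_vec_def)
      moreover have "us ! i \<bullet> us ! i > 0" "us ! j \<bullet> us ! j > 0" using ij by (auto intro: pos)
      ultimately show "(map f us ! i \<bullet>c map f us ! j = 0) = (i \<noteq> j)"
        using corthogonalD[OF us(2), of i j] ij by simp
    qed
  qed
qed

text \<open>Deflation: in an orthonormal basis that starts with an eigenvector, the first column of
  the matrix is a multiple of the first unit vector. By symmetry so is the first row, and the
  induction hypothesis diagonalises the remaining block.\<close>

lemma symmetric_real_mat_diagonalization:
  fixes A :: "real mat"
  assumes "A \<in> carrier_mat n n" and "transpose_mat A = A"
  shows "\<exists>P D. P \<in> carrier_mat n n \<and> D \<in> carrier_mat n n \<and> diagonal_mat D \<and>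
    P * transpose_mat P = 1\<^sub>m n \<and> transpose_mat P * P = 1\<^sub>m n \<and> A = P * D * transpose_mat P"
  using assms
proof (induction n arbitrary: A)
  case 0
  then show ?case
    by (intro exI[of _ A]) (auto simp: diagonal_mat_def)
next
  case (Suc n)
  let ?N = "Suc n"
  note A = Suc.prems(1) and sym = Suc.prems(2)
  obtain e where "eigenvalue A e" using symmetric_real_mat_eigenvalue[OF A sym] by auto
  then obtain v where v: "v \<in> carrier_vec ?N" "v \<noteq> 0\<^sub>v ?N" "A *\<^sub>v v = e \<cdot>\<^sub>v v"
    unfolding eigenvalue_def eigenvector_def using A by auto
  obtain c ws where hd: "hd ws = c \<cdot>\<^sub>v v" and c: "c \<noteq> 0"
    and ws: "set ws \<subseteq> carrier_vec ?N" "corthogonal ws" "length ws = ?N"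
    and norm: "\<And>w. w \<in> set ws \<Longrightarrow> w \<bullet> w = 1"
    by (rule orthonormal_list_with_hd_parallel[OF v(1,2)]) (rule that)
  define W where "W = mat_of_cols ?N ws"
  have W: "W \<in> carrier_mat ?N ?N" using ws by (auto simp: W_def)
  have inv: "corthogonal_inv W = transpose_mat W"
    unfolding W_def by (rule corthogonal_inv_orthonormal[OF ws(1,3) norm])
  have WtW: "transpose_mat W * W = 1\<^sub>m ?N"
    using corthogonal_inv_result[OF orthogonal_mat_of_cols[OF ws], folded W_def] W
    unfolding inv inverts_mat_def by simp
  then have WWt: "W * transpose_mat W = 1\<^sub>m ?N"
    using mat_mult_left_right_inverse[of "transpose_mat W" ?N W] W by simp
  define B where "B = transpose_mat W * A * W"
  have B: "B \<in> carrier_mat ?N ?N" using A W by (simp add: B_def)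
  have symB: "transpose_mat B = B"
    unfolding B_def using A W sym
    by (simp add: transpose_mult[of _ ?N ?N _ ?N] assoc_mult_mat[of _ ?N ?N _ ?N _ ?N])
  have symB': "B $$ (i,j) = B $$ (j,i)" if "i < ?N" "j < ?N" for i j
    using arg_cong[OF symB, of "\<lambda>M. M $$ (i,j)"] that B by simp
  \<comment> \<open>Rescaling by the nonzero \<open>c\<close> keeps \<open>v\<close> an eigenvector,
    so the first column of \<open>W\<close> is one too.\<close>
  have "c \<cdot>\<^sub>v v \<noteq> 0\<^sub>v ?N" using v c by (auto simp: vec_eq_iff)
  moreover have "A *\<^sub>v (c \<cdot>\<^sub>v v) = e \<cdot>\<^sub>v (c \<cdot>\<^sub>v v)"
    using A v by (simp add: mult_mat_vec smult_smult_assoc mult.commute)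
  ultimately have col0: "col B 0 = vec ?N (\<lambda>i. if i = 0 then e else 0)"
    using corthogonal_col_ev_0[OF A _ _ _ _ hd ws, of e] v(1) unfolding B_def W_def[symmetric] inv by simp
  have col: "B $$ (i,0) = (if i = 0 then e else 0)" if "i < ?N" for i
    using arg_cong[OF col0, of "\<lambda>w. w $ i"] that B by simp
  define B' where "B' = mat n n (\<lambda>(i,j). B $$ (Suc i, Suc j))"
  have B': "B' \<in> carrier_mat n n" by (simp add: B'_def)
  have "transpose_mat B' = B'"
    by (rule eq_matI) (auto simp: B'_def symB')
  then obtain P D where PD: "P \<in> carrier_mat n n" "D \<in> carrier_mat n n" "diagonal_mat D"
    "P * transpose_mat P = 1\<^sub>m n" "transpose_mat P * P = 1\<^sub>m n" "B' = P * D * transpose_mat P"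
    using Suc.IH[OF B'] by blast
  let ?E = "mat 1 1 (\<lambda>_. e)"
  define Q where "Q = four_block_mat (1\<^sub>m 1) (0\<^sub>m 1 n) (0\<^sub>m n 1) P"
  define F where "F = four_block_mat ?E (0\<^sub>m 1 n) (0\<^sub>m n 1) D"
  have Bblock: "B = four_block_mat ?E (0\<^sub>m 1 n) (0\<^sub>m n 1) B'"
  proof (rule eq_matI)
    fix i j assume ij: "i < dim_row (four_block_mat ?E (0\<^sub>m 1 n) (0\<^sub>m n 1) B')"
      "j < dim_col (four_block_mat ?E (0\<^sub>m 1 n) (0\<^sub>m n 1) B')"
    then have ij': "i < ?N" "j < ?N" using B' by auto
    have "B $$ (0,j) = (if j = 0 then e else 0)" using col[OF ij'(2)] symB'[of 0 j] ij' by simp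
    then show "B $$ (i,j) = four_block_mat ?E (0\<^sub>m 1 n) (0\<^sub>m n 1) B' $$ (i,j)"
      using col[OF ij'(1)] ij ij' B' by (auto simp: B'_def)
  qed (use B B' in auto)
  have Qt: "transpose_mat Q = four_block_mat (1\<^sub>m 1) (0\<^sub>m 1 n) (0\<^sub>m n 1) (transpose_mat P)"
    unfolding Q_def using PD(1) by (subst transpose_four_block_mat) auto
  have Q: "Q \<in> carrier_mat ?N ?N" and F: "F \<in> carrier_mat ?N ?N"
    using PD by (auto simp: Q_def F_def)
  have one: "four_block_mat (1\<^sub>m 1) (0\<^sub>m 1 n) (0\<^sub>m n 1) (1\<^sub>m n) = (1\<^sub>m ?N :: real mat)"
    by (simp only: four_block_one_mat) simp
  have QQt: "Q * transpose_mat Q = 1\<^sub>m ?N" "transpose_mat Q * Q = 1\<^sub>m ?N"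
    unfolding Qt unfolding Q_def using PD(1,4,5)
    by (simp_all add: mult_four_block_mat[of _ 1 1 _ n _ n _ _ 1 _ n] one)
  have BQ: "B = Q * F * transpose_mat Q"
    unfolding Bblock Qt unfolding Q_def F_def using PD(1,2,6)
    by (simp add: mult_four_block_mat[of _ 1 1 _ n _ n _ _ 1 _ n])
  have diag: "diagonal_mat F"
    using PD(2,3) unfolding F_def diagonal_mat_def by auto
  have W': "transpose_mat W \<in> carrier_mat ?N ?N" and Q': "transpose_mat Q \<in> carrier_mat ?N ?N"
    using W Q by auto
  note assoc = assoc_mult_mat[of _ ?N ?N _ ?N _ ?N]
  have WQt: "transpose_mat (W * Q) = transpose_mat Q * transpose_mat W"
    using W Q by (simp add: transpose_mult)
  \<comment> \<open>Undo the conjugation: \<open>W * Q\<close> is again orthogonal and carries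
    \<open>F\<close> to \<open>A\<close>.\<close>
  have "A = (W * transpose_mat W) * A * (W * transpose_mat W)" using A WWt by simp
  also have "\<dots> = W * B * transpose_mat W"
    unfolding B_def using A W W' by (simp add: assoc)
  also have "\<dots> = (W * Q) * F * transpose_mat (W * Q)"
    unfolding BQ WQt using W W' Q Q' F by (simp add: assoc)
  finally have "A = (W * Q) * F * transpose_mat (W * Q)" .
  moreover have "(W * Q) * transpose_mat (W * Q) = W * (Q * transpose_mat Q) * transpose_mat W"
    unfolding WQt using W W' Q Q' by (simp add: assoc)
  then have "(W * Q) * transpose_mat (W * Q) = 1\<^sub>m ?N" using QQt WWt W by simp
  moreover have "transpose_mat (W * Q) * (W * Q) = transpose_mat Q * (transpose_mat W * W) * Q"
    unfolding WQt using W W' Q Q' by (simp add: assoc)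
  then have "transpose_mat (W * Q) * (W * Q) = 1\<^sub>m ?N" using QQt WtW Q Q' by simp
  ultimately show ?case using W Q F diag by (intro exI[of _ "W * Q"] exI[of _ F]) auto
qed

section \<open>Parseval's identity and the spectral decomposition in coordinates\<close>

text \<open>Expanding the square leaves the Gram matrix of the columns, which is the identity. The
  rows are treated by the same lemma with the arguments of \<open>P\<close> swapped.\<close>

lemma orthonormal_sum_squares:
  fixes P :: "nat \<Rightarrow> nat \<Rightarrow> real"
  assumes "\<And>l m. l < n \<Longrightarrow> m < n \<Longrightarrow> (\<Sum>i<n. P i l * P i m) = (if l = m then 1 else 0)"
  shows "(\<Sum>i<n. (\<Sum>l<n. P i l * c l)\<^sup>2) = (\<Sum>l<n. (c l)\<^sup>2)"
proof -
  have "(\<Sum>i<n. (\<Sum>l<n. P i l * c l)\<^sup>2) = (\<Sum>i<n. \<Sum>l<n. \<Sum>m<n. c l * c m * (P i l * P i m))"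
    by (simp add: power2_eq_square sum_product mult_ac)
  also have "\<dots> = (\<Sum>l<n. \<Sum>i<n. \<Sum>m<n. c l * c m * (P i l * P i m))" by (rule sum.swap)
  also have "\<dots> = (\<Sum>l<n. \<Sum>m<n. \<Sum>i<n. c l * c m * (P i l * P i m))"
    by (intro sum.cong refl sum.swap)
  also have "\<dots> = (\<Sum>l<n. \<Sum>m<n. c l * c m * (if l = m then 1 else 0))"
    by (intro sum.cong refl) (simp add: assms flip: sum_distrib_left)
  also have "\<dots> = (\<Sum>l<n. (c l)\<^sup>2)"
    by (intro sum.cong refl) (simp add: power2_eq_square if_distrib cong: if_cong)
  finally show ?thesis .
qed

text \<open>This is (P diag(f) P^T)(P diag(g) P^T) = P diag(f g) P^T in entries, where the inner P^T
  P collapses. Applied twice, it yields the entries of A^3.\<close>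

lemma orthonormal_conjugate_diagonal_mult:
  fixes P :: "nat \<Rightarrow> nat \<Rightarrow> real"
  assumes "\<And>l m. l < n \<Longrightarrow> m < n \<Longrightarrow> (\<Sum>i<n. P i l * P i m) = (if l = m then 1 else 0)"
  shows "(\<Sum>k<n. (\<Sum>l<n. P i l * f l * P k l) * (\<Sum>l<n. P k l * g l * P j l))
    = (\<Sum>l<n. P i l * (f l * g l) * P j l)"
proof -
  have "(\<Sum>k<n. (\<Sum>l<n. P i l * f l * P k l) * (\<Sum>l<n. P k l * g l * P j l))
    = (\<Sum>k<n. \<Sum>l<n. \<Sum>m<n. P i l * f l * g m * P j m * (P k l * P k m))"
    by (simp add: sum_product mult_ac)
  also have "\<dots> = (\<Sum>l<n. \<Sum>k<n. \<Sum>m<n. P i l * f l * g m * P j m * (P k l * P k m))"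
    by (rule sum.swap)
  also have "\<dots> = (\<Sum>l<n. \<Sum>m<n. \<Sum>k<n. P i l * f l * g m * P j m * (P k l * P k m))"
    by (intro sum.cong refl sum.swap)
  also have "\<dots> = (\<Sum>l<n. \<Sum>m<n. P i l * f l * g m * P j m * (if l = m then 1 else 0))"
    by (intro sum.cong refl) (simp add: assms flip: sum_distrib_left)
  also have "\<dots> = (\<Sum>l<n. P i l * (f l * g l) * P j l)"
    by (intro sum.cong refl) (simp add: if_distrib mult_ac cong: if_cong)
  finally show ?thesis .
qed

lemma index_mult_mat_sum:
  assumes "A \<in> carrier_mat n n" "B \<in> carrier_mat n n" "i < n" "j < n"
  shows "(A * B) $$ (i,j) = (\<Sum>k<n. A $$ (i,k) * B $$ (k,j))"
  using assms by (simp add: scalar_prod_def lessThan_atLeast0)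

text \<open>The spectral theorem as sums over indices. The polynomial of
  \<open>- 1 \<cdot>\<^sub>m A\<close> is recorded with the same \<open>e\<close>, so that a
  similarity between A and -A gives two factorisations of one polynomial.\<close>

lemma symmetric_real_mat_spectral:
  fixes A :: "real mat"
  assumes A: "A \<in> carrier_mat n n" and sym: "transpose_mat A = A"
  obtains e :: "nat \<Rightarrow> real" and P :: "nat \<Rightarrow> nat \<Rightarrow> real"
  where "char_poly A = (\<Prod>x\<leftarrow>map e [0..<n]. [:- x, 1:])"
    and "char_poly (- 1 \<cdot>\<^sub>m A) = (\<Prod>x\<leftarrow>map (\<lambda>l. - e l) [0..<n]. [:- x, 1:])"
    and "\<And>i j. i < n \<Longrightarrow> j < n \<Longrightarrow> A $$ (i,j) = (\<Sum>l<n. P i l * e l * P j l)"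
    and "\<And>l m. l < n \<Longrightarrow> m < n \<Longrightarrow> (\<Sum>i<n. P i l * P i m) = (if l = m then 1 else 0)"
    and "\<And>i j. i < n \<Longrightarrow> j < n \<Longrightarrow> (\<Sum>l<n. P i l * P j l) = (if i = j then 1 else 0)"
proof -
  obtain Q D where Q: "Q \<in> carrier_mat n n" and D: "D \<in> carrier_mat n n" and diag: "diagonal_mat D"
    and QQt: "Q * transpose_mat Q = 1\<^sub>m n" and QtQ: "transpose_mat Q * Q = 1\<^sub>m n"
    and AQ: "A = Q * D * transpose_mat Q"
    using symmetric_real_mat_diagonalization[OF A sym] by blast
  define e where "e l = D $$ (l,l)" for l
  define P where "P i l = Q $$ (i,l)" for i l
  have sim: "similar_mat A D"
    by (rule similar_matI[of _ _ Q "transpose_mat Q" n]) (use A D Q QQt QtQ AQ in auto)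
  have tri: "upper_triangular D" using diag D by (auto simp: diagonal_mat_def)
  show thesis
  proof (rule that)
    have "char_poly A = (\<Prod>x\<leftarrow>diag_mat D. [:- x, 1:])"
      using char_poly_similar[OF sim] char_poly_upper_triangular[OF D tri] by simp
    also have "diag_mat D = map e [0..<n]" using D by (auto simp: diag_mat_def e_def)
    finally show "char_poly A = (\<Prod>x\<leftarrow>map e [0..<n]. [:- x, 1:])" .
    have D': "- 1 \<cdot>\<^sub>m D \<in> carrier_mat n n" using D by simp
    have tri': "upper_triangular (- 1 \<cdot>\<^sub>m D)"
      using diag D by (auto simp: diagonal_mat_def upper_triangular_def)
    have "char_poly (- 1 \<cdot>\<^sub>m A) = (\<Prod>x\<leftarrow>diag_mat (- 1 \<cdot>\<^sub>m D). [:- x, 1:])"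
      using char_poly_similar[OF similar_mat_smult[OF sim, of "- 1"]]
        char_poly_upper_triangular[OF D' tri'] by simp
    also have "diag_mat (- 1 \<cdot>\<^sub>m D) = map (\<lambda>l. - e l) [0..<n]"
      using D by (auto simp: diag_mat_def e_def)
    finally show "char_poly (- 1 \<cdot>\<^sub>m A) = (\<Prod>x\<leftarrow>map (\<lambda>l. - e l) [0..<n]. [:- x, 1:])" .
    show "A $$ (i,j) = (\<Sum>l<n. P i l * e l * P j l)" if ij: "i < n" "j < n" for i j
    proof -
      have "(Q * D) $$ (i,l) = P i l * e l" if l: "l < n" for l
      proof -
        have "(Q * D) $$ (i,l) = (\<Sum>m<n. Q $$ (i,m) * D $$ (m,l))"
          by (rule index_mult_mat_sum[OF Q D ij(1) l])
        also have "\<dots> = (\<Sum>m<n. if m = l then Q $$ (i,l) * D $$ (l,l) else 0)"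
          using diag D l by (intro sum.cong refl) (auto simp: diagonal_mat_def)
        finally show ?thesis using l by (simp add: P_def e_def)
      qed
      moreover have "A $$ (i,j) = (\<Sum>l<n. (Q * D) $$ (i,l) * transpose_mat Q $$ (l,j))"
        unfolding AQ by (rule index_mult_mat_sum) (use Q D ij in auto)
      ultimately show ?thesis using Q ij by (simp add: P_def)
    qed
    show "(\<Sum>i<n. P i l * P i m) = (if l = m then 1 else 0)" if lm: "l < n" "m < n" for l m
      using arg_cong[OF QtQ, of "\<lambda>M. M $$ (l,m)"] Q lm
      by (simp add: scalar_prod_def lessThan_atLeast0 P_def)
    show "(\<Sum>l<n. P i l * P j l) = (if i = j then 1 else 0)" if ij: "i < n" "j < n" for i j
      using arg_cong[OF QQt, of "\<lambda>M. M $$ (i,j)"] Q ij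
      by (simp add: scalar_prod_def lessThan_atLeast0 P_def)
  qed
qed

section \<open>Adjacency matrices and walks\<close>

lemma adj_matrix_carrier: "pverts G = {1..n} \<Longrightarrow> adj_matrix G \<in> carrier_mat n n"
  by (simp add: adj_matrix_def)

lemma adj_matrix_index:
  assumes "pverts G = {1..n}" "i < n" "j < n"
  shows "adj_matrix G $$ (i,j) = (if (Suc i, Suc j) \<in> parcs G then 1 else 0)"
  using assms by (simp add: adj_matrix_def)

lemma transpose_adj_matrix:
  assumes "pair_graph G" "pverts G = {1..n}"
  shows "transpose_mat (adj_matrix G) = adj_matrix G"
proof -
  interpret pair_graph G by fact
  show ?thesis
    by (rule eq_matI) (use assms in \<open>auto simp: adj_matrix_def intro: arcs_symmetric\<close>)
qed

text \<open>Conjugate by the diagonal matrix \<open>S\<close> with entries 1 on U and -1 on V. Each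
  arc joins U to V, so each nonzero entry changes sign; as \<open>S\<close> is its own inverse, A
  and -A are similar.\<close>

lemma char_poly_uminus_adj_matrix_bipartite:
  assumes G: "pair_graph G" "pverts G = {1..n}" and "bipartite G"
  shows "char_poly (- 1 \<cdot>\<^sub>m adj_matrix G) = char_poly (adj_matrix G)"
proof -
  obtain U V where UV: "pverts G = U \<union> V" "U \<inter> V = {}" "parcs G \<subseteq> U \<times> V \<union> V \<times> U"
    using \<open>bipartite G\<close> unfolding bipartite_def by blast
  let ?A = "adj_matrix G"
  have A: "?A \<in> carrier_mat n n" by (rule adj_matrix_carrier[OF G(2)])
  define s :: "nat \<Rightarrow> real" where "s i = (if Suc i \<in> U then 1 else - 1)" for i
  define S where "S = mat n n (\<lambda>(i,j). if i = j then s i else 0)"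
  have S: "S \<in> carrier_mat n n" by (simp add: S_def)
  have SM: "(S * M) $$ (i,j) = s i * M $$ (i,j)" if "M \<in> carrier_mat n n" "i < n" "j < n" for i j M
  proof -
    have "(S * M) $$ (i,j) = (\<Sum>k<n. if k = i then s i * M $$ (i,j) else 0)"
      unfolding index_mult_mat_sum[OF S that] using that
      by (intro sum.cong) (auto simp: S_def)
    then show ?thesis using that by simp
  qed
  have MS: "(M * S) $$ (i,j) = M $$ (i,j) * s j" if "M \<in> carrier_mat n n" "i < n" "j < n" for i j M
  proof -
    have "(M * S) $$ (i,j) = (\<Sum>k<n. if k = j then M $$ (i,j) * s j else 0)"
      unfolding index_mult_mat_sum[OF that(1) S that(2,3)] using that
      by (intro sum.cong) (auto simp: S_def)
    then show ?thesis using that by simp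
  qed
  have "S * S = 1\<^sub>m n"
    by (rule eq_matI) (use S in \<open>auto simp: SM simp del: index_mult_mat(1)\<close>, auto simp: S_def s_def)
  moreover have "- 1 \<cdot>\<^sub>m ?A = S * ?A * S"
  proof (rule eq_matI)
    fix i j assume "i < dim_row (S * ?A * S)" "j < dim_col (S * ?A * S)"
    then have ij: "i < n" "j < n" using S by auto
    have "(S * ?A * S) $$ (i,j) = s i * ?A $$ (i,j) * s j"
      using ij S A by (simp add: MS SM del: index_mult_mat(1))
    also have "\<dots> = - ?A $$ (i,j)"
      using UV ij by (auto simp: adj_matrix_index[OF G(2)] s_def)
    finally show "(- 1 \<cdot>\<^sub>m ?A) $$ (i,j) = (S * ?A * S) $$ (i,j)" using A ij by simp
  qed (use A S in auto)
  ultimately have "similar_mat (- 1 \<cdot>\<^sub>m ?A) ?A"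
    by (intro similar_matI[of _ _ S S n]) (use A S in auto)
  then show ?thesis by (rule char_poly_similar)
qed

section \<open>Walk counts and their growth\<close>

lemma sum_pverts_shift:
  assumes "pverts G = {1..n}"
  shows "(\<Sum>i\<in>pverts G. f i) = (\<Sum>i<n. f (Suc i))"
  unfolding assms by (rule sum.reindex_bij_witness[of _ Suc "\<lambda>i. i - 1"]) auto

lemma num_walks_Suc_adj_matrix:
  assumes G: "pair_graph G" "pverts G = {1..n}" and i: "i < n"
  shows "real (num_walks G (Suc k) (Suc i)) = (\<Sum>j<n. adj_matrix G $$ (i,j) * real (num_walks G k (Suc j)))"
proof -
  interpret pair_graph G by fact
  have "real (num_walks G (Suc k) (Suc i)) = (\<Sum>j | (Suc i, j) \<in> parcs G. real (num_walks G k j))"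
    using num_walks_Suc[OF G(1), of "Suc i" k] G(2) i by simp
  also have "\<dots> = (\<Sum>j\<in>pverts G. if (Suc i, j) \<in> parcs G then real (num_walks G k j) else 0)"
    by (rule sum.mono_neutral_cong_left) (auto dest: in_arcsD2)
  also have "\<dots> = (\<Sum>j<n. adj_matrix G $$ (i,j) * real (num_walks G k (Suc j)))"
    unfolding sum_pverts_shift[OF G(2)] using i
    by (intro sum.cong refl) (simp add: adj_matrix_index[OF G(2)])
  finally show ?thesis .
qed

text \<open>A symmetric connected digraph is strongly connected, so a path leads from
  \<open>u\<close> to another vertex; its first arc gives the neighbour.\<close>

lemma connected_ex_neighbour:
  assumes G: "pair_graph G" and con: "Digraph_Component.connected (with_proj G)"
    and u: "u \<in> pverts G" and v: "v \<in> pverts G" "u \<noteq> v"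
  shows "\<exists>w. (u, w) \<in> parcs G"
proof -
  interpret pair_graph G by fact
  have "strongly_connected (with_proj G)"
    by (rule symmetric_connected_imp_strongly_connected[OF sym_arcs con])
  then have "u \<rightarrow>\<^sup>*\<^bsub>with_proj G\<^esub> v" using u v by (auto simp: strongly_connected_def)
  then show ?thesis using v(2)
    by (induction rule: converse_reachable_induct) auto
qed

text \<open>Any walk from a neighbour of \<open>u\<close> extends to one from \<open>u\<close>.
  Positivity keeps the denominator in \<open>walk_gamma\<close> away from zero.\<close>

lemma num_walks_pos:
  assumes G: "pair_graph G" and nb: "\<And>u. u \<in> pverts G \<Longrightarrow> \<exists>w. (u, w) \<in> parcs G"
    and "u \<in> pverts G"
  shows "num_walks G k u > 0"
  using \<open>u \<in> pverts G\<close>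
proof (induction k arbitrary: u)
  case 0
  then show ?case by (simp add: num_walks_0)
next
  case (Suc k)
  interpret pair_graph G by fact
  obtain w where w: "(u, w) \<in> parcs G" using nb[OF Suc.prems] by blast
  have sub: "{j. (u, j) \<in> parcs G} \<subseteq> pverts G" by (auto dest: in_arcsD2)
  have fin: "finite {j. (u, j) \<in> parcs G}" using finite_subset[OF sub pair_finite_verts] .
  have "0 < num_walks G k w" using w by (auto intro!: Suc.IH dest: in_arcsD2)
  also have "\<dots> \<le> (\<Sum>j | (u, j) \<in> parcs G. num_walks G k j)"
    using w fin by (intro member_le_sum) auto
  finally show ?case using num_walks_Suc[OF G Suc.prems] by simp
qed

text \<open>After one step the walk count is constant on each part, namely the sum of the previous
  counts over the opposite part. This makes the sum of squares grow by exactly the factor p q at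
  each step.\<close>

lemma complete_bipartite_walk_gamma:
  assumes G: "pair_graph G" and UV: "pverts G = U \<union> V" "U \<inter> V = {}" "parcs G = U \<times> V \<union> V \<times> U"
    and "finite U" "finite V" "U \<noteq> {}" "V \<noteq> {}"
  shows "(walk_gamma G k)\<^sup>2 = real (card U) * real (card V)"
proof -
  let ?w = "\<lambda>k i. real (num_walks G k i)"
  let ?p = "real (card U)" and ?q = "real (card V)"
  define S where "S k = (\<Sum>i\<in>pverts G. (?w k i)\<^sup>2)" for k
  define sU where "sU k = (\<Sum>i\<in>U. ?w k i)" for k
  define sV where "sV k = (\<Sum>i\<in>V. ?w k i)" for k
  have S: "S k = (\<Sum>i\<in>U. (?w k i)\<^sup>2) + (\<Sum>i\<in>V. (?w k i)\<^sup>2)" for k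
    unfolding S_def UV(1) using assms by (intro sum.union_disjoint) auto
  have wU: "?w (Suc k) i = sV k" if "i \<in> U" for i k
  proof -
    have "{j. (i, j) \<in> parcs G} = V" using that UV by auto
    then show ?thesis using num_walks_Suc[OF G, of i k] that UV by (simp add: sV_def)
  qed
  have wV: "?w (Suc k) i = sU k" if "i \<in> V" for i k
  proof -
    have "{j. (i, j) \<in> parcs G} = U" using that UV by auto
    then show ?thesis using num_walks_Suc[OF G, of i k] that UV by (simp add: sU_def)
  qed
  have SS: "S (Suc k) = ?p * (sV k)\<^sup>2 + ?q * (sU k)\<^sup>2" for k by (simp add: S wU wV)
  have "S (Suc k) = ?p * ?q * S k"
  \<comment> \<open>\<open>SS\<close> describes only sums of squares at successors, so
    \<open>S 0\<close> is computed directly.\<close>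
  proof (cases k)
    case 0
    have "?w 0 i = 1" if "i \<in> pverts G" for i using that by (simp add: num_walks_0)
    then have "S 0 = ?p + ?q" "sU 0 = ?p" "sV 0 = ?q" using UV by (auto simp: S sU_def sV_def)
    then show ?thesis unfolding 0 SS by (simp add: power2_eq_square algebra_simps)
  next
    case (Suc m)
    have "sU k = ?p * sV m" "sV k = ?q * sU m"
      unfolding Suc sU_def sV_def by (simp_all add: wU wV flip: sU_def sV_def)
    then show ?thesis unfolding SS[of k] using SS[of m] Suc by (simp add: power2_eq_square algebra_simps)
  qed
  moreover have "S k > 0"
  proof -
    obtain u where u: "u \<in> pverts G" using UV assms by auto
    have "num_walks G k u > 0" using UV assms by (intro num_walks_pos[OF G _ u]) auto
    then show ?thesis unfolding S_def using u assms by (intro sum_pos2[of _ u]) auto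
  qed
  ultimately show ?thesis by (simp add: walk_gamma_def flip: S_def)
qed

text \<open>Strict positivity will separate an eigenvalue of modulus at least gamma from its
  negative.\<close>

lemma walk_gamma_pos:
  assumes G: "pair_graph G" and nb: "\<And>u. u \<in> pverts G \<Longrightarrow> \<exists>w. (u, w) \<in> parcs G" and "pverts G \<noteq> {}"
  shows "walk_gamma G k > 0"
proof -
  interpret pair_graph G by fact
  have "(\<Sum>i\<in>pverts G. (real (num_walks G k i))\<^sup>2) > 0" for k
    using num_walks_pos[OF G nb] \<open>pverts G \<noteq> {}\<close> by (intro sum_pos) auto
  then show ?thesis unfolding walk_gamma_def by simp
qed

text \<open>Follow a path from a vertex of U to a vertex of V: closing walks of length 3 shortens it
  step by step to a single arc.\<close>

lemma complete_bipartite_if_walk3_closed: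
  assumes G: "pair_graph G" and con: "Digraph_Component.connected (with_proj G)"
    and UV: "pverts G = U \<union> V" "U \<inter> V = {}" "parcs G \<subseteq> U \<times> V \<union> V \<times> U"
    and walk3: "\<And>u a b v. (u, a) \<in> parcs G \<Longrightarrow> (a, b) \<in> parcs G \<Longrightarrow> (b, v) \<in> parcs G \<Longrightarrow> (u, v) \<in> parcs G"
  shows "parcs G = U \<times> V \<union> V \<times> U"
proof -
  interpret pair_graph G by fact
  have sc: "strongly_connected (with_proj G)"
    by (rule symmetric_connected_imp_strongly_connected[OF sym_arcs con])
  have edge: "(u, v) \<in> parcs G" if "u \<in> U" "v \<in> V" for u v
  proof -
    have "u \<rightarrow>\<^sup>*\<^bsub>with_proj G\<^esub> v" using sc that UV by (auto simp: strongly_connected_def)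
    \<comment> \<open>The claim is strengthened for the induction: reached vertices of V are
      adjacent to \<open>u\<close>, and reached vertices of U are \<open>u\<close> itself or two
      arcs away. A step into V then ends a walk of length 1 or 3 from \<open>u\<close>; a step into
      U starts at a neighbour of \<open>u\<close>.\<close>
    then have "(v \<in> V \<longrightarrow> (u, v) \<in> parcs G) \<and>
      (v \<in> U \<longrightarrow> v = u \<or> (\<exists>a. (u, a) \<in> parcs G \<and> (a, v) \<in> parcs G))"
    proof (induction rule: reachable_induct)
      case base
      then show ?case using \<open>u \<in> U\<close> UV by auto
    next
      case (step x y)
      from step(2) have xy: "(x, y) \<in> parcs G" by simp
      then consider "x \<in> U" "y \<in> V" | "x \<in> V" "y \<in> U" using UV by auto
      then show ?case
      proof cases
        case 1
        then show ?thesis using step.IH xy UV walk3 by blast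
      next
        case 2
        then show ?thesis using step.IH xy UV by blast
      qed
    qed
    then show ?thesis using that by blast
  qed
  then have "(v, u) \<in> parcs G" if "u \<in> U" "v \<in> V" for u v
    using that arcs_symmetric by blast
  with edge show ?thesis using UV by blast
qed

section \<open>The Estrada index of a bipartite graph\<close>

text \<open>The excess of the sum over the bound splits into two nonnegative parts: one from the
  pair, as cosh is even and increases on nonnegative reals, and one from the other terms, as cosh is
  at least 1. Equality makes both vanish, and cosh is injective on nonnegative reals with value 1
  only at 0.\<close>

lemma sum_cosh_opposite_pair:
  fixes e :: "nat \<Rightarrow> real"
  assumes ab: "a < n" "b < n" "a \<noteq> b" and e: "e b = - e a" and g: "0 \<le> g" "g \<le> \<bar>e a\<bar>"
  shows "2 * cosh g + real n - 2 \<le> (\<Sum>l<n. cosh (e l))" (is "?L \<le> ?R")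
    and "(\<Sum>l<n. cosh (e l)) = 2 * cosh g + real n - 2
      \<longleftrightarrow> g = \<bar>e a\<bar> \<and> (\<forall>l\<in>{..<n} - {a,b}. e l = 0)"
proof -
  let ?S = "{..<n} - {a,b}"
  have card: "real (card ?S) = real n - 2" using ab by (simp add: card_Diff_subset)
  have "(\<Sum>l<n. cosh (e l)) = cosh (e a) + (cosh (e b) + (\<Sum>l\<in>?S. cosh (e l)))"
    using ab by (subst sum.remove[of _ a], simp, simp, subst sum.remove[of _ b])
      (auto simp: insert_commute Diff_insert2[symmetric])
  also have "\<dots> = 2 * cosh (e a) + (\<Sum>l\<in>?S. cosh (e l))" by (simp add: e)
  also have "\<dots> = (2 * cosh g + real n - 2) + (2 * (cosh \<bar>e a\<bar> - cosh g) + (\<Sum>l\<in>?S. cosh (e l) - 1))"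
    by (simp add: sum_subtractf card)
  finally have R: "?R = ?L + (2 * (cosh \<bar>e a\<bar> - cosh g) + (\<Sum>l\<in>?S. cosh (e l) - 1))" .
  have 1: "cosh \<bar>e a\<bar> - cosh g \<ge> 0" using g by (simp add: cosh_real_nonneg_le_iff del: cosh_real_abs)
  have 2: "(\<Sum>l\<in>?S. cosh (e l) - 1) \<ge> 0" by (intro sum_nonneg) (simp add: cosh_real_ge_1)
  show "?L \<le> ?R" using R 1 2 by simp
  have "x + (2 * y + z) = x \<longleftrightarrow> y = 0 \<and> z = 0" if "y \<ge> 0" "z \<ge> 0" for x y z :: real
    using that by auto
  from this[OF 1 2] have "?R = ?L \<longleftrightarrow> cosh \<bar>e a\<bar> - cosh g = 0 \<and> (\<Sum>l\<in>?S. cosh (e l) - 1) = 0"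
    unfolding R .
  also have "cosh \<bar>e a\<bar> - cosh g = 0 \<longleftrightarrow> g = \<bar>e a\<bar>"
    using g by auto
  also have "(\<Sum>l\<in>?S. cosh (e l) - 1) = 0 \<longleftrightarrow> (\<forall>l\<in>?S. e l = 0)"
    by (subst sum_nonneg_eq_0_iff) (auto simp: cosh_real_ge_1 cosh_real_one_iff)
  finally show "?R = ?L \<longleftrightarrow> g = \<bar>e a\<bar> \<and> (\<forall>l\<in>?S. e l = 0)" .
qed

text \<open>Averaging the sums of exp over the two root lists turns exp into cosh.\<close>

lemma estrada_index_eq_sum_cosh:
  assumes e: "char_poly (adj_matrix G) = (\<Prod>x\<leftarrow>map e [0..<n]. [:- x, 1:])"
    and e': "char_poly (adj_matrix G) = (\<Prod>x\<leftarrow>map (\<lambda>l. - e l) [0..<n]. [:- x, 1:])"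
  shows "estrada_index G = (\<Sum>l<n. cosh (e l))"
proof -
  have "estrada_index G = (\<Sum>l<n. exp (e l))"
    using estrada_index_eq_sum_list[OF e] by (simp add: interv_sum_list_conv_sum_set_nat lessThan_atLeast0 o_def)
  moreover have "estrada_index G = (\<Sum>l<n. exp (- e l))"
    using estrada_index_eq_sum_list[OF e'] by (simp add: interv_sum_list_conv_sum_set_nat lessThan_atLeast0 o_def)
  ultimately show ?thesis
    by (simp add: cosh_plus_sinh[symmetric] cosh_minus_sinh[symmetric] sum.distrib sum_subtractf)
qed

section \<open>The lower bound and its equality case\<close>

theorem theorem6:
  fixes G :: "nat pair_pre_digraph" and n k :: nat
  assumes "pair_graph G"
    and "pverts G = {1..n}"
    and "n > 2"
    and "Digraph_Component.connected (with_proj G)"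
    and "bipartite G"
  shows "estrada_index G \<ge> 2 * cosh (walk_gamma G k) + real n - 2
    \<and> (estrada_index G = 2 * cosh (walk_gamma G k) + real n - 2
        \<longleftrightarrow> (\<exists>p q. p + q = n \<and> complete_bipartite_digraph p q (with_proj G)))"
proof -
  note G = assms(1,2)
  interpret pair_graph G by fact
  let ?A = "adj_matrix G" and ?g = "walk_gamma G k"
  have A: "?A \<in> carrier_mat n n" by (rule adj_matrix_carrier[OF G(2)])
  obtain e P where char: "char_poly ?A = (\<Prod>x\<leftarrow>map e [0..<n]. [:- x, 1:])"
    and "char_poly (- 1 \<cdot>\<^sub>m ?A) = (\<Prod>x\<leftarrow>map (\<lambda>l. - e l) [0..<n]. [:- x, 1:])"
    and AP: "\<And>i j. i < n \<Longrightarrow> j < n \<Longrightarrow> ?A $$ (i,j) = (\<Sum>l<n. P i l * e l * P j l)"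
    and cols: "\<And>l m. l < n \<Longrightarrow> m < n \<Longrightarrow> (\<Sum>i<n. P i l * P i m) = (if l = m then 1 else 0)"
    and rows: "\<And>i j. i < n \<Longrightarrow> j < n \<Longrightarrow> (\<Sum>l<n. P i l * P j l) = (if i = j then 1 else 0)"
    using symmetric_real_mat_spectral[OF A transpose_adj_matrix[OF G]] by blast
  then have char': "char_poly ?A = (\<Prod>x\<leftarrow>map (\<lambda>l. - e l) [0..<n]. [:- x, 1:])"
    using char_poly_uminus_adj_matrix_bipartite[OF G \<open>bipartite G\<close>] by simp
  have EE: "estrada_index G = (\<Sum>l<n. cosh (e l))"
    by (rule estrada_index_eq_sum_cosh[OF char char'])
  have neighbour: "\<exists>w. (u, w) \<in> parcs G" if "u \<in> pverts G" for u
  proof -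
    define v :: nat where "v = (if u = 1 then 2 else 1)"
    have "v \<in> pverts G" "u \<noteq> v" using \<open>n > 2\<close> G(2) by (auto simp: v_def)
    then show ?thesis using connected_ex_neighbour[OF G(1) assms(4) that] by blast
  qed
  have g: "?g > 0" by (rule walk_gamma_pos[OF G(1) neighbour]) (use G \<open>n > 2\<close> in auto)

  have "Max ((\<lambda>l. \<bar>e l\<bar>) ` {..<n}) \<in> (\<lambda>l. \<bar>e l\<bar>) ` {..<n}"
    using \<open>n > 2\<close> by (intro Max_in) auto
  then obtain a where a: "a < n" and "\<bar>e a\<bar> = Max ((\<lambda>l. \<bar>e l\<bar>) ` {..<n})" by auto
  then have max: "\<bar>e l\<bar> \<le> \<bar>e a\<bar>" if "l < n" for l using that by simp

  have g_le: "?g \<le> \<bar>e a\<bar>"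
  proof -
    \<comment> \<open>The numbers \<open>y l\<close> are the coordinates of the walk vector
      \<open>w\<close> in the eigenbasis, and one more step multiplies \<open>y l\<close> by
      \<open>e l\<close>. Parseval for the columns evaluates the numerator of gamma squared, and
      Parseval for the rows the denominator.\<close>
    define w where "w i = real (num_walks G k (Suc i))" for i
    define y where "y l = (\<Sum>i<n. P i l * w i)" for l
    have Aw: "real (num_walks G (Suc k) (Suc i)) = (\<Sum>l<n. P i l * (e l * y l))" if "i < n" for i
    proof -
      have "real (num_walks G (Suc k) (Suc i)) = (\<Sum>j<n. \<Sum>l<n. P i l * e l * P j l * w j)"
        using that by (simp add: num_walks_Suc_adj_matrix[OF G] AP w_def sum_distrib_right)
      also have "\<dots> = (\<Sum>l<n. \<Sum>j<n. P i l * e l * P j l * w j)" by (rule sum.swap)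
      finally show ?thesis by (simp add: y_def sum_distrib_left mult.assoc)
    qed
    have "(\<Sum>i\<in>pverts G. (real (num_walks G (k + 1) i))\<^sup>2) = (\<Sum>l<n. (e l * y l)\<^sup>2)"
      unfolding sum_pverts_shift[OF G(2)]
      using orthonormal_sum_squares[OF cols, of "\<lambda>l. e l * y l"] by (simp add: Aw)
    also have "\<dots> \<le> (\<Sum>l<n. (e a)\<^sup>2 * (y l)\<^sup>2)"
      using max by (intro sum_mono) (auto simp: power_mult_distrib abs_le_square_iff intro: mult_right_mono)
    also have "\<dots> = (e a)\<^sup>2 * (\<Sum>i<n. (w i)\<^sup>2)"
      unfolding y_def using orthonormal_sum_squares[of n "\<lambda>l i. P i l" w, OF rows]
      by (simp flip: sum_distrib_left)
    finally have le: "(\<Sum>i\<in>pverts G. (real (num_walks G (k + 1) i))\<^sup>2)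
      \<le> (e a)\<^sup>2 * (\<Sum>i\<in>pverts G. (real (num_walks G k i))\<^sup>2)"
      unfolding sum_pverts_shift[OF G(2)] w_def .
    have "(\<Sum>i\<in>pverts G. (real (num_walks G k i))\<^sup>2) > 0"
      using num_walks_pos[OF G(1) neighbour] G(2) \<open>n > 2\<close> by (intro sum_pos) auto
    then have "?g \<le> sqrt ((e a)\<^sup>2)"
      unfolding walk_gamma_def using le by (intro real_sqrt_le_mono) (simp add: divide_le_eq)
    then show ?thesis by simp
  qed

  \<comment> \<open>The negated list also consists of roots, so \<open>- e a\<close> occurs in the
    original list, at some index \<open>b\<close>.\<close>
  have "poly (char_poly ?A) (- e a) = 0"
    unfolding char' using a by (auto simp: poly_prod_list prod_list_zero_iff)
  then obtain b where b: "b < n" "e b = - e a"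
    unfolding char by (auto simp: poly_prod_list prod_list_zero_iff)
  have "a \<noteq> b" using b g g_le by auto
  note pair = sum_cosh_opposite_pair[OF a b(1) \<open>a \<noteq> b\<close> b(2) less_imp_le[OF g] g_le, folded EE]

  have "(?g = \<bar>e a\<bar> \<and> (\<forall>l\<in>{..<n} - {a,b}. e l = 0))
    \<longleftrightarrow> (\<exists>p q. p + q = n \<and> complete_bipartite_digraph p q (with_proj G))"
  proof
    assume zero: "?g = \<bar>e a\<bar> \<and> (\<forall>l\<in>{..<n} - {a,b}. e l = 0)"
    \<comment> \<open>Every eigenvalue is now \<open>e a\<close>, \<open>- e a\<close> or 0.\<close>
    have cube: "e l * (e l * e l) = (e a)\<^sup>2 * e l" if "l < n" for l
      using zero that b(2) by (cases "l = a \<or> l = b") (auto simp: power2_eq_square)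
    have A3: "(\<Sum>x<n. ?A $$ (i,x) * (\<Sum>y<n. ?A $$ (x,y) * ?A $$ (y,j))) = (e a)\<^sup>2 * ?A $$ (i,j)"
      if "i < n" "j < n" for i j
    proof -
      have "(\<Sum>x<n. ?A $$ (i,x) * (\<Sum>y<n. ?A $$ (x,y) * ?A $$ (y,j)))
        = (\<Sum>l<n. P i l * (e l * (e l * e l)) * P j l)"
        using that by (simp add: AP orthonormal_conjugate_diagonal_mult[OF cols])
      also have "\<dots> = (e a)\<^sup>2 * ?A $$ (i,j)"
        using that by (simp add: cube AP sum_distrib_left mult_ac)
      finally show ?thesis .
    qed
    have nonneg: "?A $$ (i,j) \<ge> 0" if "i < n" "j < n" for i j
      using that by (simp add: adj_matrix_index[OF G(2)])
    have walk3: "(u, v) \<in> parcs G"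
      if arcs: "(u, x) \<in> parcs G" "(x, y) \<in> parcs G" "(y, v) \<in> parcs G" for u x y v
    proof -
      have "{u, x, y, v} \<subseteq> {1..n}" using arcs G(2) by (auto dest: in_arcsD1 in_arcsD2)
      then obtain i x' y' j where eq: "u = Suc i" "x = Suc x'" "y = Suc y'" "v = Suc j"
        and lt: "i < n" "x' < n" "y' < n" "j < n"
        by (cases u; cases x; cases y; cases v) auto
      have one: "?A $$ (i,x') = 1" "?A $$ (x',y') = 1" "?A $$ (y',j) = 1"
        using arcs eq lt by (simp_all add: adj_matrix_index[OF G(2)])
      \<comment> \<open>All entries are nonnegative, so this single walk already makes the (i,j)
        entry of A^3 at least 1. That entry is a multiple of the (i,j) entry of A, which therefore
        cannot vanish.\<close>
      have "1 = ?A $$ (x',y') * ?A $$ (y',j)" using one by simp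
      also have "\<dots> \<le> (\<Sum>y<n. ?A $$ (x',y) * ?A $$ (y,j))"
        using lt nonneg by (intro member_le_sum[where f = "\<lambda>y. ?A $$ (x',y) * ?A $$ (y,j)"]) auto
      also have "\<dots> = ?A $$ (i,x') * (\<Sum>y<n. ?A $$ (x',y) * ?A $$ (y,j))" using one by simp
      also have "\<dots> \<le> (\<Sum>x<n. ?A $$ (i,x) * (\<Sum>y<n. ?A $$ (x,y) * ?A $$ (y,j)))"
        using lt nonneg
        by (intro member_le_sum[where f = "\<lambda>x. ?A $$ (i,x) * (\<Sum>y<n. ?A $$ (x,y) * ?A $$ (y,j))"])
          (auto intro!: mult_nonneg_nonneg sum_nonneg)
      also have "\<dots> = (e a)\<^sup>2 * ?A $$ (i,j)" using A3 lt by simp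
      finally have "?A $$ (i,j) \<noteq> 0" by auto
      then show ?thesis using lt eq by (auto simp: adj_matrix_index[OF G(2)] split: if_splits)
    qed
    obtain U V where UV: "pverts G = U \<union> V" "U \<inter> V = {}" "parcs G \<subseteq> U \<times> V \<union> V \<times> U"
      using \<open>bipartite G\<close> unfolding bipartite_def by blast
    have "parcs G = U \<times> V \<union> V \<times> U"
      by (rule complete_bipartite_if_walk3_closed[OF G(1) assms(4) UV walk3])
    moreover have "finite U" "finite V" using pair_finite_verts unfolding UV(1) by auto
    then have "card U + card V = card (pverts G)" by (simp add: UV(1) card_Un_disjoint[OF _ _ UV(2)])
    then have "card U + card V = n" by (simp add: G(2))
    ultimately show "\<exists>p q. p + q = n \<and> complete_bipartite_digraph p q (with_proj G)"
      using UV(1,2) pair_finite_verts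
      by (intro exI[of _ "card U"] exI[of _ "card V"]) (auto simp: complete_bipartite_digraph_pair_def)
  next
    assume "\<exists>p q. p + q = n \<and> complete_bipartite_digraph p q (with_proj G)"
    then obtain U V where UV: "pverts G = U \<union> V" "U \<inter> V = {}" "parcs G = U \<times> V \<union> V \<times> U"
      unfolding complete_bipartite_digraph_pair_def by blast
    have fin: "finite U" "finite V" using pair_finite_verts unfolding UV(1) by auto
    have "1 \<in> pverts G" using G(2) \<open>n > 2\<close> by simp
    then have ne: "U \<noteq> {}" "V \<noteq> {}" using neighbour[of 1] UV by auto
    have g2: "?g\<^sup>2 = real (card U) * real (card V)"
      by (rule complete_bipartite_walk_gamma[OF G(1) UV fin ne])
    \<comment> \<open>The sum of squared eigenvalues is the sum of squared entries of A, by Parseval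
      in each column of A. For a 0-1 matrix this counts the arcs, grouped here by their
      heads.\<close>
    have "(\<Sum>l<n. (e l)\<^sup>2) = (\<Sum>l<n. (e l)\<^sup>2 * (\<Sum>j<n. P j l * P j l))"
      by (simp add: cols)
    also have "\<dots> = (\<Sum>l<n. \<Sum>j<n. (e l * P j l)\<^sup>2)"
      by (simp add: sum_distrib_left power2_eq_square mult_ac)
    also have "\<dots> = (\<Sum>j<n. \<Sum>l<n. (e l * P j l)\<^sup>2)" by (rule sum.swap)
    also have "\<dots> = (\<Sum>j<n. \<Sum>i<n. (?A $$ (i,j))\<^sup>2)"
    proof (rule sum.cong[OF refl])
      fix j assume "j \<in> {..<n}"
      then show "(\<Sum>l<n. (e l * P j l)\<^sup>2) = (\<Sum>i<n. (?A $$ (i,j))\<^sup>2)"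
        using orthonormal_sum_squares[OF cols, of "\<lambda>l. e l * P j l"] by (simp add: AP mult.assoc)
    qed
    also have "\<dots> = (\<Sum>j<n. \<Sum>i<n. if (Suc i, Suc j) \<in> parcs G then 1 else 0)"
      by (intro sum.cong refl) (simp add: adj_matrix_index[OF G(2)])
    also have "\<dots> = (\<Sum>j\<in>pverts G. \<Sum>i\<in>pverts G. if (i, j) \<in> parcs G then 1 else 0)"
      by (simp add: sum_pverts_shift[OF G(2)])
    also have "\<dots> = (\<Sum>j\<in>pverts G. real (card {i\<in>pverts G. (i, j) \<in> parcs G}))"
      using pair_finite_verts by (simp add: sum.If_cases Int_def)
    also have "\<dots> = (\<Sum>j\<in>U. real (card {i\<in>pverts G. (i, j) \<in> parcs G}))
        + (\<Sum>j\<in>V. real (card {i\<in>pverts G. (i, j) \<in> parcs G}))"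
      unfolding UV(1) using fin UV(2) by (rule sum.union_disjoint)
    also have "\<dots> = (\<Sum>j\<in>U. real (card V)) + (\<Sum>j\<in>V. real (card U))"
    proof -
      have "{i\<in>pverts G. (i, j) \<in> parcs G} = V" if "j \<in> U" for j using that UV by auto
      moreover have "{i\<in>pverts G. (i, j) \<in> parcs G} = U" if "j \<in> V" for j using that UV by auto
      ultimately show ?thesis by simp
    qed
    also have "\<dots> = 2 * ?g\<^sup>2" by (simp add: g2)
    finally have "(\<Sum>l<n. (e l)\<^sup>2) = 2 * ?g\<^sup>2" .
    moreover have "(\<Sum>l<n. (e l)\<^sup>2) = (e a)\<^sup>2 + ((e b)\<^sup>2 + (\<Sum>l\<in>{..<n} - {a,b}. (e l)\<^sup>2))"
      using a b \<open>a \<noteq> b\<close> by (subst sum.remove[of _ a], simp, simp, subst sum.remove[of _ b])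
        (auto simp: insert_commute Diff_insert2[symmetric])
    moreover have "?g\<^sup>2 \<le> (e a)\<^sup>2" using g g_le by (simp add: abs_le_square_iff[symmetric])
    moreover have nonneg: "(\<Sum>l\<in>{..<n} - {a,b}. (e l)\<^sup>2) \<ge> 0" by (simp add: sum_nonneg)
    \<comment> \<open>The total 2 g^2 equals 2 (e a)^2 plus the nonnegative rest, and g^2 is at most
      (e a)^2; so both inequalities are equalities.\<close>
    ultimately have "?g\<^sup>2 = (e a)\<^sup>2" and rest: "(\<Sum>l\<in>{..<n} - {a,b}. (e l)\<^sup>2) = 0"
      using b(2) by auto
    then have "?g = \<bar>e a\<bar>" using g power2_eq_iff_nonneg[of ?g "\<bar>e a\<bar>"] by simp
    moreover have "\<forall>l\<in>{..<n} - {a,b}. e l = 0"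
      using rest by (subst (asm) sum_nonneg_eq_0_iff) auto
    ultimately show "?g = \<bar>e a\<bar> \<and> (\<forall>l\<in>{..<n} - {a,b}. e l = 0)" by blast
  qed
  with pair show ?thesis by blast
qed

end
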